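(* Let $n\ge 1$ and for each $1\le i<j\le n$ let $m_{ij}\in\mathbb{R}\cup\{-\infty\}$ and $M_{ij}\in\mathbb{R}\cup\{\infty\}$ with $m_{ij}<M_{ij}$. The weighted digraphical polytope given by the system of inequalities $$m_{ij}<x_i-x_j<M_{ij},\quad 1\le i<j\le n,$$ is not empty and bounded if and only if the weighted digraph associated to this system is $m$-acyclic and strongly connected.
   Context: $V_{n-1}=\{x\in\mathbb{R}^n: x_1+\cdots+x_n=0\}$. The weighted digraphical polytope given by a system $m_{ij}<x_i-x_j<M_{ij}$ ($1\le i<j\le n$) is its solution set in $V_{n-1}$. The weighted digraph associated to the system has vertex set $\{1,\ldots,n\}$; for each $i<j$ it has a directed edge $i\rightarrow j$ of weight $m_{ij}$ if $m_{ij}>-\infty$, and a directed edge $j\rightarrow i$ of weight $-M_{ij}$ if $M_{ij}<\infty$; it has no other edges. An $m$-ascending cycle in the associated weighted digraph is a directed cycle along which the sum of the weights is nonnegative. The weighted digraph is $m$-acyclic if it contains no $m$-ascending cycle. (Here "$m$-" is just part of the name.) A digraph is strongly connected if every vertex is reachable from every vertex by a directed path; a one-vertex digraph is strongly connected. *)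

theory Defs
  imports
    "HOL-Analysis.Analysis"
    "Graph_Theory.Pair_Digraph"
    "Graph_Theory.Digraph_Component"
begin

text \<open>
  The index set \<open>{1,\<dots>,n}\<close> is represented by an arbitrary finite linearly ordered type
  \<open>'n\<close> with \<open>n = CARD('n)\<close>.  The bounds are extended reals; only their values at
  \<open>(i, j)\<close> with \<open>i < j\<close> are used.
\<close>

definition zero_sum_space :: "(real ^ 'n) set" where
  "zero_sum_space = {x. (\<Sum>i\<in>UNIV. x $ i) = 0}"

definition digraphical_polytope ::
  "('n::{finite,linorder} \<Rightarrow> 'n \<Rightarrow> ereal) \<Rightarrow> ('n \<Rightarrow> 'n \<Rightarrow> ereal) \<Rightarrow> (real, 'n) vec set" where
  "digraphical_polytope m M =
    {x \<in> zero_sum_space. \<forall>i j. i < j \<longrightarrow> m i j < ereal (x $ i - x $ j) \<and> ereal (x $ i - x $ j) < M i j}"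

definition assoc_digraph ::
  "('n::{finite,linorder} \<Rightarrow> 'n \<Rightarrow> ereal) \<Rightarrow> ('n \<Rightarrow> 'n \<Rightarrow> ereal) \<Rightarrow> 'n pair_pre_digraph" where
  "assoc_digraph m M =
    \<lparr> pverts = UNIV,
      parcs = {(i, j) | i j. i < j \<and> m i j > -\<infinity>} \<union> {(j, i) | i j. i < j \<and> M i j < \<infinity>} \<rparr>"

text \<open>
  On the arcs of the associated digraph the relevant bound is finite whenever
  \<open>m i j < M i j\<close> for all \<open>i < j\<close>, so the conversion to real numbers loses nothing there;
  values off the arcs are irrelevant.
\<close>

definition assoc_weight ::
  "('n::{finite,linorder} \<Rightarrow> 'n \<Rightarrow> ereal) \<Rightarrow> ('n \<Rightarrow> 'n \<Rightarrow> ereal) \<Rightarrow> 'n \<times> 'n \<Rightarrow> real" where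
  "assoc_weight m M =
    (\<lambda>(u, v). if u < v then real_of_ereal (m u v) else - real_of_ereal (M v u))"

text \<open>Cycles are nonempty lists of arcs, and repeat no vertex apart from the common endpoint.\<close>

definition m_ascending_cycle :: "('a, 'b) pre_digraph \<Rightarrow> ('b \<Rightarrow> real) \<Rightarrow> 'b list \<Rightarrow> bool" where
  "m_ascending_cycle G w p \<longleftrightarrow> pre_digraph.cycle G p \<and> 0 \<le> sum_list (map w p)"

definition m_acyclic :: "('a, 'b) pre_digraph \<Rightarrow> ('b \<Rightarrow> real) \<Rightarrow> bool" where
  "m_acyclic G w \<longleftrightarrow> (\<nexists>p. m_ascending_cycle G w p)"

end

theory Submission
  imports Defs "Graph_Theory.Shortest_Path"
begin

text \<open>
  An arc \<open>u \<rightarrow> v\<close> of weight \<open>w\<close> encodes the constraint \<open>w < x\<^sub>u - x\<^sub>v\<close>, so a point of the polytope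
  is a potential on the vertices whose drop along each arc strictly exceeds the weight of the arc.
  Drops telescope along walks, and this gives both halves of the equivalence.

  \<^item> \<^emph>\<open>Nonempty iff acyclic\<close> (\<open>digraphical_polytope_nonempty_iff\<close>).  Around a cycle the total drop is
    zero, so a potential forces every cycle to have negative weight.  Conversely, there are finitely
    many cycles, so if all of them have negative weight then every arc weight can be raised by a
    common \<open>\<epsilon> > 0\<close> without making any cycle positive (\<open>cycle_slack\<close>).  The greatest raised weight of
    a path starting at \<open>u\<close> is then a potential with drop at least \<open>w + \<epsilon>\<close> on each arc
    (\<open>strict_potential_exists\<close>).  A potential only matters up to an additive constant, so it can be
    moved into the hyperplane of zero coordinate sum.

  \<^item> \<^emph>\<open>Bounded iff strongly connected, for a nonempty polytope\<close>.  If every vertex reaches every other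
    one, then each difference \<open>x\<^sub>u - x\<^sub>v\<close> is bounded below by the weight of some walk from \<open>u\<close> to \<open>v\<close>,
    and above by exchanging the roles of \<open>u\<close> and \<open>v\<close>; on the hyperplane this bounds every
    coordinate.  If some vertex set \<open>S\<close> other than the empty and the full one has no outgoing arc,
    then lowering the coordinates in \<open>S\<close> relative to the others violates no constraint, so the
    polytope contains a ray.
\<close>

section \<open>Walk weights and potentials\<close>

lemma (in wf_digraph) awalk_cost_le_potential_drop:
  fixes x :: "'a \<Rightarrow> real"
  assumes "\<And>e. e \<in> arcs G \<Longrightarrow> w e \<le> x (tail G e) - x (head G e)"
    and "awalk u p v"
  shows "awalk_cost w p \<le> x u - x v"
  using assms(2)
proof (induction p arbitrary: u)
  case Nil
  then show ?case by (simp add: awalk_Nil_iff)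
next
  case (Cons e p)
  then have "awalk_cost w p \<le> x (head G e) - x v" "w e \<le> x u - x (head G e)"
    using assms(1) by (auto simp: awalk_Cons_iff)
  then show ?case by simp
qed

lemma (in wf_digraph) awalk_cost_less_potential_drop:
  fixes x :: "'a \<Rightarrow> real"
  assumes drop: "\<And>e. e \<in> arcs G \<Longrightarrow> w e < x (tail G e) - x (head G e)"
    and "awalk u p v" "p \<noteq> []"
  shows "awalk_cost w p < x u - x v"
proof -
  obtain e q where p: "p = e # q" using \<open>p \<noteq> []\<close> by (cases p) auto
  with \<open>awalk u p v\<close> have e: "e \<in> arcs G" "u = tail G e" and q: "awalk (head G e) q v"
    by (auto simp: awalk_Cons_iff)
  have "awalk_cost w q \<le> x (head G e) - x v"
    using drop q by (intro awalk_cost_le_potential_drop) (auto intro: less_imp_le)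
  with drop[OF e(1)] show ?thesis by (simp add: p e(2))
qed

text \<open>
  A nonempty closed walk that is not a cycle revisits a vertex and splits there into two shorter closed
  walks, so nonnegativity passes from cycles to all closed walks.
\<close>

lemma (in wf_digraph) closed_walk_cost_nonneg:
  assumes cyc: "\<And>p. cycle p \<Longrightarrow> 0 \<le> awalk_cost f p"
    and "awalk u p u"
  shows "0 \<le> awalk_cost f p"
  using assms(2)
proof (induction "length p" arbitrary: u p rule: less_induct)
  case less
  show ?case
  proof (cases "p = [] \<or> distinct (tl (awalk_verts u p))")
    case True
    then consider "p = []" | "cycle p" using less.prems by (auto simp: cycle_def)
    then show ?thesis by cases (simp_all add: cyc)
  next
    case False
    then obtain e es where p: "p = e # es" by (cases p) auto
    with False less.prems have es: "awalk (head G e) es u" "\<not> distinct (awalk_verts (head G e) es)"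
      and e: "e \<in> arcs G" "u = tail G e"
      by (auto simp: awalk_Cons_iff)
    obtain q r s where split: "es = q @ r @ s" "0 < length r"
      and walks: "\<exists>w. awalk (head G e) q w \<and> awalk w r w \<and> awalk w s u"
      using awalk_not_distinct_decomp[OF es] by blast
    from walks obtain w where w: "awalk (head G e) q w" "awalk w r w" "awalk w s u"
      by blast
    have "awalk u (e # q @ s) u"
      using awalk_appendI[OF w(1,3)] e by (simp add: awalk_Cons_iff)
    then have "0 \<le> awalk_cost f (e # q @ s)"
      using split p by (intro less.hyps) auto
    moreover have "0 \<le> awalk_cost f r"
      using split p by (intro less.hyps[OF _ w(2)]) auto
    ultimately show ?thesis by (simp add: p split)
  qed
qed

lemma (in fin_digraph) finite_cycles: "finite {p. cycle p}"
proof (rule finite_subset)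
  show "{p. cycle p} \<subseteq> {p. set p \<subseteq> arcs G \<and> distinct p}"
    by (auto simp: cycle_conv)
qed (rule finite_subset_distinct[OF finite_arcs])

lemma (in wf_digraph) awalk_cost_add_const:
  "awalk_cost (\<lambda>e. w e + c) p = awalk_cost w p + real (length p) * c"
  by (induction p) (auto simp: algebra_simps)

text \<open>
  The gap between strict inequalities on the arcs and strict inequalities on the cycles is bridged
  by finiteness: the mean arc weights of the cycles stay away from zero.
\<close>

lemma (in fin_digraph) cycle_slack:
  assumes neg: "\<And>p. cycle p \<Longrightarrow> awalk_cost w p < 0"
  obtains \<epsilon> where "\<epsilon> > 0" "\<And>p. cycle p \<Longrightarrow> awalk_cost (\<lambda>e. w e + \<epsilon>) p \<le> 0"
proof -
  \<comment> \<open>The element \<open>1\<close> only makes the minimum meaningful when there is no cycle at all.\<close>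
  define A where "A = insert 1 ((\<lambda>p. - awalk_cost w p / real (length p)) ` {p. cycle p})"
  have fin: "finite A" "A \<noteq> {}"
    using finite_cycles by (auto simp: A_def)
  show ?thesis
  proof
    have "- awalk_cost w p / real (length p) > 0" if "cycle p" for p
      using neg[OF that] that by (intro divide_pos_pos) (auto simp: cycle_def)
    then have "a > 0" if "a \<in> A" for a
      using that by (auto simp: A_def)
    then show "Min A > 0" using fin by simp
  next
    fix p assume p: "cycle p"
    then have len: "real (length p) > 0" by (auto simp: cycle_def)
    have "Min A \<le> - awalk_cost w p / real (length p)"
      using fin p by (intro Min_le) (auto simp: A_def)
    with len have "real (length p) * Min A \<le> - awalk_cost w p"
      by (simp only: pos_le_divide_eq mult.commute)
    then show "awalk_cost (\<lambda>e. w e + Min A) p \<le> 0"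
      by (simp add: awalk_cost_add_const)
  qed
qed

text \<open>
  The potential is minus the least cost of a path starting at the given vertex, with an arbitrary end.
  Prepending an arc to a path may produce a walk that is not a path, but in the absence of negative
  cycles shortcutting it does not increase the cost.
\<close>

lemma (in fin_digraph) strict_potential_exists:
  assumes neg: "\<And>p. cycle p \<Longrightarrow> awalk_cost w p < 0"
  obtains x :: "'a \<Rightarrow> real" where "\<And>e. e \<in> arcs G \<Longrightarrow> w e < x (tail G e) - x (head G e)"
proof -
  obtain \<epsilon> where eps: "\<epsilon> > 0" "\<And>p. cycle p \<Longrightarrow> awalk_cost (\<lambda>e. w e + \<epsilon>) p \<le> 0"
    using cycle_slack[OF neg] by blast
  define f where "f = (\<lambda>e. - (w e + \<epsilon>))"
  have f_cost: "awalk_cost f p = - awalk_cost (\<lambda>e. w e + \<epsilon>) p" for p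
    by (induction p) (simp_all add: f_def)
  have closed: "0 \<le> awalk_cost f p" if "awalk u p u" for u p
    using eps(2) by (intro closed_walk_cost_nonneg[OF _ that]) (simp add: f_cost)
  define P where "P u = {p. \<exists>v. apath u p v}" for u
  have fin: "finite (P u)" for u
    by (rule finite_surj[OF apaths_finite_triple, of _ "fst \<circ> snd"]) (force simp: P_def)
  define D where "D u = Min (awalk_cost f ` P u)" for u
  have arc: "D (tail G e) \<le> f e + D (head G e)" if e: "e \<in> arcs G" for e
  proof -
    have "[] \<in> P (head G e)" using e by (auto simp: P_def apath_Nil_iff)
    then have "D (head G e) \<in> awalk_cost f ` P (head G e)"
      unfolding D_def using fin by (intro Min_in) auto
    then obtain p v where p: "apath (head G e) p v" "D (head G e) = awalk_cost f p"
      by (auto simp: P_def)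
    have walk: "awalk (tail G e) (e # p) v"
      using p(1) e by (auto simp: apath_def awalk_Cons_iff)
    have "awalk_to_apath (e # p) \<in> P (tail G e)"
      using apath_awalk_to_apath[OF walk] by (auto simp: P_def)
    then have "D (tail G e) \<le> awalk_cost f (awalk_to_apath (e # p))"
      unfolding D_def using fin by (intro Min_le) auto
    also have "\<dots> \<le> awalk_cost f (e # p)"
      using closed by (intro awalk_to_path_no_neg_cyc_cost[OF walk]) (auto simp: not_less)
    finally show ?thesis by (simp add: p(2))
  qed
  show thesis
  proof (rule that[of "\<lambda>u. - D u"])
    fix e assume "e \<in> arcs G"
    from arc[OF this] eps(1) show "w e < - D (tail G e) - - D (head G e)"
      by (simp add: f_def)
  qed
qed

section \<open>The polytope as a set of potentials\<close>

lemma fin_digraph_assoc_digraph: "fin_digraph (with_proj (assoc_digraph m M))"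
  by unfold_locales (auto simp: assoc_digraph_def)

text \<open>
  Infinite bounds impose nothing and have no arc.  The hypotheses exclude an upper bound \<open>-\<infinity>\<close> and a
  lower bound \<open>\<infinity>\<close>, so on arcs the weight is the bound itself and not a default value of
  \<^const>\<open>real_of_ereal\<close>.
\<close>

lemma digraphical_polytope_iff:
  assumes "\<And>i j. i < j \<Longrightarrow> m i j \<noteq> \<infinity>"
    and "\<And>i j. i < j \<Longrightarrow> M i j \<noteq> -\<infinity>"
  shows "x \<in> digraphical_polytope m M \<longleftrightarrow> x \<in> zero_sum_space \<and>
    (\<forall>(u, v) \<in> parcs (assoc_digraph m M). assoc_weight m M (u, v) < x $ u - x $ v)"
proof -
  have lower: "m i j < ereal r \<longleftrightarrow> (m i j > -\<infinity> \<longrightarrow> real_of_ereal (m i j) < r)" if "i < j" for i j r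
    using assms(1)[OF that] by (cases "m i j") auto
  have upper: "ereal (a - b) < M i j \<longleftrightarrow> (M i j < \<infinity> \<longrightarrow> - real_of_ereal (M i j) < b - a)"
    if "i < j" for i j a b
    using assms(2)[OF that] by (cases "M i j") auto
  have weight: "assoc_weight m M (i, j) = real_of_ereal (m i j)"
    "assoc_weight m M (j, i) = - real_of_ereal (M i j)" if "i < j" for i j
    using that by (auto simp: assoc_weight_def)
  have "(\<forall>i j. i < j \<longrightarrow> m i j < ereal (x $ i - x $ j) \<and> ereal (x $ i - x $ j) < M i j) \<longleftrightarrow>
    (\<forall>i j. i < j \<and> m i j > -\<infinity> \<longrightarrow> real_of_ereal (m i j) < x $ i - x $ j) \<and>
    (\<forall>i j. i < j \<and> M i j < \<infinity> \<longrightarrow> - real_of_ereal (M i j) < x $ j - x $ i)"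
    using lower upper by meson
  also have "\<dots> \<longleftrightarrow> (\<forall>(u, v) \<in> parcs (assoc_digraph m M). assoc_weight m M (u, v) < x $ u - x $ v)"
    by (auto simp: assoc_digraph_def ball_Un Ball_def weight)
  finally show ?thesis by (simp add: digraphical_polytope_def)
qed

lemma digraphical_polytope_walk_bound:
  assumes "\<And>i j. i < j \<Longrightarrow> m i j \<noteq> \<infinity>"
    and "\<And>i j. i < j \<Longrightarrow> M i j \<noteq> -\<infinity>"
    and "x \<in> digraphical_polytope m M"
    and "pre_digraph.awalk (with_proj (assoc_digraph m M)) u p v"
  shows "sum_list (map (assoc_weight m M) p) \<le> x $ u - x $ v"
    and "p \<noteq> [] \<Longrightarrow> sum_list (map (assoc_weight m M) p) < x $ u - x $ v"
proof -
  interpret fin_digraph "with_proj (assoc_digraph m M)"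
    by (rule fin_digraph_assoc_digraph)
  have drop: "assoc_weight m M e < x $ fst e - x $ snd e" if "e \<in> parcs (assoc_digraph m M)" for e
    using assms(3) that by (auto simp: digraphical_polytope_iff[OF assms(1,2)])
  show "sum_list (map (assoc_weight m M) p) \<le> x $ u - x $ v"
    using awalk_cost_le_potential_drop[OF _ assms(4), of "assoc_weight m M" "($) x"] drop
    by (simp add: awalk_cost_def less_imp_le)
  show "sum_list (map (assoc_weight m M) p) < x $ u - x $ v" if "p \<noteq> []"
    using awalk_cost_less_potential_drop[OF _ assms(4) that, of "assoc_weight m M" "($) x"] drop
    by (simp add: awalk_cost_def)
qed

theorem digraphical_polytope_nonempty_iff:
  fixes m M :: "'n::{finite,linorder} \<Rightarrow> 'n \<Rightarrow> ereal"
  assumes "\<And>i j. i < j \<Longrightarrow> m i j \<noteq> \<infinity>"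
    and "\<And>i j. i < j \<Longrightarrow> M i j \<noteq> -\<infinity>"
  shows "digraphical_polytope m M \<noteq> {} \<longleftrightarrow>
    m_acyclic (with_proj (assoc_digraph m M)) (assoc_weight m M)" (is "_ \<longleftrightarrow> m_acyclic ?G ?w")
proof -
  interpret fin_digraph ?G
    by (rule fin_digraph_assoc_digraph)
  show ?thesis
  proof
    assume "digraphical_polytope m M \<noteq> {}"
    then obtain x where x: "x \<in> digraphical_polytope m M" by blast
    have "sum_list (map ?w p) < 0" if cyc: "cycle p" for p
    proof -
      from cyc obtain u where u: "awalk u p u" "p \<noteq> []" by (auto simp: cycle_def)
      show ?thesis
        using digraphical_polytope_walk_bound(2)[OF assms x u] by simp
    qed
    then show "m_acyclic ?G ?w"
      by (force simp: m_acyclic_def m_ascending_cycle_def)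
  next
    assume "m_acyclic ?G ?w"
    then have "awalk_cost ?w p < 0" if "cycle p" for p
      using that by (force simp: m_acyclic_def m_ascending_cycle_def awalk_cost_def)
    then obtain y where y: "\<And>e. e \<in> arcs ?G \<Longrightarrow> ?w e < y (tail ?G e) - y (head ?G e)"
      using strict_potential_exists[of ?w] by blast
    define c where "c = (\<Sum>i\<in>UNIV. y i) / real CARD('n)"
    define x :: "(real, 'n) vec" where "x = (\<chi> i. y i - c)"
    have "x \<in> zero_sum_space"
      by (simp add: zero_sum_space_def x_def sum_subtractf c_def)
    moreover have "?w (u, v) < x $ u - x $ v" if "(u, v) \<in> parcs (assoc_digraph m M)" for u v
      using y[of "(u, v)"] that by (simp add: x_def)
    ultimately have "x \<in> digraphical_polytope m M"
      by (auto simp: digraphical_polytope_iff[OF assms])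
    then show "digraphical_polytope m M \<noteq> {}" by blast
  qed
qed

section \<open>Boundedness and strong connectivity\<close>

text \<open>
  On the zero-sum hyperplane \<open>n x\<^sub>u\<close> is the sum of the differences \<open>x\<^sub>u - x\<^sub>v\<close>, so bounds on the
  differences are bounds on the coordinates.
\<close>

lemma bounded_zero_sum_if_differences_bounded:
  fixes P :: "(real ^ 'n) set"
  assumes zero: "P \<subseteq> zero_sum_space"
    and lower: "\<And>x u v. x \<in> P \<Longrightarrow> C u v \<le> x $ u - x $ v"
  shows "bounded P"
proof -
  define K where "K u = (\<Sum>v\<in>UNIV. \<bar>C u v\<bar> + \<bar>C v u\<bar>)" for u
  have coord: "\<bar>x $ u\<bar> \<le> K u" if x: "x \<in> P" for x u
  proof -
    have "(\<Sum>v\<in>UNIV. x $ u - x $ v) = real CARD('n) * x $ u"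
      using zero x by (auto simp: zero_sum_space_def sum_subtractf)
    then have "real CARD('n) * \<bar>x $ u\<bar> = \<bar>\<Sum>v\<in>UNIV. x $ u - x $ v\<bar>"
      by (simp add: abs_mult)
    also have "\<dots> \<le> (\<Sum>v\<in>UNIV. \<bar>x $ u - x $ v\<bar>)"
      by (rule sum_abs)
    also have "\<dots> \<le> K u"
      unfolding K_def
    proof (rule sum_mono)
      fix v
      show "\<bar>x $ u - x $ v\<bar> \<le> \<bar>C u v\<bar> + \<bar>C v u\<bar>"
        using lower[OF x, of u v] lower[OF x, of v u] by linarith
    qed
    finally have le: "real CARD('n) * \<bar>x $ u\<bar> \<le> K u" .
    have "1 * \<bar>x $ u\<bar> \<le> real CARD('n) * \<bar>x $ u\<bar>"
      by (rule mult_right_mono) (simp_all add: Suc_le_eq)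
    with le show ?thesis by simp
  qed
  have "norm x \<le> (\<Sum>u\<in>UNIV. K u)" if "x \<in> P" for x
  proof -
    have "norm x \<le> (\<Sum>u\<in>UNIV. \<bar>x $ u\<bar>)" by (rule norm_le_l1_cart)
    also have "\<dots> \<le> (\<Sum>u\<in>UNIV. K u)" by (rule sum_mono) (rule coord[OF that])
    finally show ?thesis .
  qed
  then show ?thesis by (auto simp: bounded_iff)
qed

lemma bounded_if_strongly_connected:
  assumes "\<And>i j. i < j \<Longrightarrow> m i j \<noteq> \<infinity>"
    and "\<And>i j. i < j \<Longrightarrow> M i j \<noteq> -\<infinity>"
    and sc: "strongly_connected (with_proj (assoc_digraph m M))"
  shows "bounded (digraphical_polytope m M)"
proof -
  interpret fin_digraph "with_proj (assoc_digraph m M)"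
    by (rule fin_digraph_assoc_digraph)
  have "pverts (assoc_digraph m M) = UNIV"
    by (simp add: assoc_digraph_def)
  with sc have "u \<rightarrow>\<^sup>*\<^bsub>with_proj (assoc_digraph m M)\<^esub> v" for u v
    by (simp add: strongly_connected_def)
  then have "\<exists>p. awalk u p v" for u v
    by (simp only: reachable_awalk)
  then obtain p where p: "\<And>u v. awalk u (p u v) v" by metis
  show ?thesis
  proof (rule bounded_zero_sum_if_differences_bounded)
    show "digraphical_polytope m M \<subseteq> zero_sum_space"
      by (auto simp: digraphical_polytope_def)
    show "sum_list (map (assoc_weight m M) (p u v)) \<le> x $ u - x $ v"
      if "x \<in> digraphical_polytope m M" for x u v
      by (rule digraphical_polytope_walk_bound(1)[OF assms(1,2) that p])
  qed
qed

text \<open>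
  The set of vertices reachable from a fixed vertex has no outgoing arc.  If it is not everything, the
  direction that is negative on it and positive on its complement is a recession direction of the
  polytope; the two values are chosen to make the coordinates sum to zero.
\<close>

lemma strongly_connected_if_bounded:
  fixes m M :: "'n::{finite,linorder} \<Rightarrow> 'n \<Rightarrow> ereal"
  assumes "\<And>i j. i < j \<Longrightarrow> m i j \<noteq> \<infinity>"
    and "\<And>i j. i < j \<Longrightarrow> M i j \<noteq> -\<infinity>"
    and ne: "digraphical_polytope m M \<noteq> {}"
    and bdd: "bounded (digraphical_polytope m M)"
  shows "strongly_connected (with_proj (assoc_digraph m M))"
proof (rule ccontr)
  let ?G = "with_proj (assoc_digraph m M)"
  interpret fin_digraph ?G
    by (rule fin_digraph_assoc_digraph)
  have verts: "pverts (assoc_digraph m M) = UNIV"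
    by (simp add: assoc_digraph_def)
  assume "\<not> strongly_connected ?G"
  then obtain r s where rs: "\<not> r \<rightarrow>\<^sup>*\<^bsub>?G\<^esub> s"
    by (auto simp: strongly_connected_def verts)
  define S where "S = {v. r \<rightarrow>\<^sup>*\<^bsub>?G\<^esub> v}"
  have r: "r \<in> S" by (simp add: S_def verts)
  have s: "s \<in> - S" using rs by (simp add: S_def)
  have no_arc_out: "v \<in> S" if "u \<in> S" "(u, v) \<in> parcs (assoc_digraph m M)" for u v
    using that reachable_adj_trans[of r u v] by (simp add: S_def)
  define d :: "(real, 'n) vec" where "d = (\<chi> i. if i \<in> S then - real (card (- S)) else real (card S))"
  have "card (- S) > 0" using s by (auto simp: card_gt_0_iff)
  then have dr: "d $ r \<le> -1" using r by (simp add: d_def)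
  have d_sum: "(\<Sum>i\<in>UNIV. d $ i) = 0"
    by (simp add: d_def sum.If_cases Compl_eq)
  have d_arc: "0 \<le> d $ u - d $ v" if "(u, v) \<in> parcs (assoc_digraph m M)" for u v
    using no_arc_out[of u v] that by (simp add: d_def)
  obtain x where x: "x \<in> digraphical_polytope m M" using ne by blast
  have ray: "x + t *\<^sub>R d \<in> digraphical_polytope m M" if "t \<ge> 0" for t
  proof -
    have "x + t *\<^sub>R d \<in> zero_sum_space"
      using x d_sum
      by (simp add: digraphical_polytope_def zero_sum_space_def sum.distrib flip: sum_distrib_left)
    moreover have "assoc_weight m M (u, v) < (x + t *\<^sub>R d) $ u - (x + t *\<^sub>R d) $ v"
      if uv: "(u, v) \<in> parcs (assoc_digraph m M)" for u v
    proof -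
      have "assoc_weight m M (u, v) < x $ u - x $ v"
        using x uv by (auto simp: digraphical_polytope_iff[OF assms(1,2)])
      also have "\<dots> \<le> x $ u - x $ v + t * (d $ u - d $ v)"
        using \<open>t \<ge> 0\<close> d_arc[OF uv] by simp
      finally show ?thesis by (simp add: algebra_simps)
    qed
    ultimately show ?thesis
      by (auto simp: digraphical_polytope_iff[OF assms(1,2)])
  qed
  obtain B where B: "\<And>y. y \<in> digraphical_polytope m M \<Longrightarrow> norm y \<le> B"
    using bdd by (auto simp: bounded_iff)
  have "0 \<le> B" using B[OF x] norm_ge_zero[of x] by linarith
  define t where "t = B + \<bar>x $ r\<bar> + 1"
  have t: "t \<ge> 0" using \<open>0 \<le> B\<close> by (simp add: t_def)
  have "\<bar>x $ r + t * d $ r\<bar> \<le> B"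
    using component_le_norm_cart[of "x + t *\<^sub>R d" r] B[OF ray[OF t]] by simp
  moreover have "t * d $ r \<le> - t"
    using mult_left_mono[OF dr t] by simp
  ultimately show False by (simp add: t_def)
qed

section \<open>The criterion\<close>

theorem theorem2p10:
  fixes m M :: "'n::{finite,linorder} \<Rightarrow> 'n \<Rightarrow> ereal"
  assumes "\<And>i j. i < j \<Longrightarrow> m i j \<noteq> \<infinity>"
    and "\<And>i j. i < j \<Longrightarrow> M i j \<noteq> -\<infinity>"
    and "\<And>i j. i < j \<Longrightarrow> m i j < M i j"
  shows "digraphical_polytope m M \<noteq> {} \<and> bounded (digraphical_polytope m M) \<longleftrightarrow>
    m_acyclic (with_proj (assoc_digraph m M)) (assoc_weight m M) \<and>
    strongly_connected (with_proj (assoc_digraph m M))"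
  using digraphical_polytope_nonempty_iff[of m M, OF assms(1,2)]
    bounded_if_strongly_connected[of m M, OF assms(1,2)]
    strongly_connected_if_bounded[of m M, OF assms(1,2)]
  by blast

end
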